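(* Let $\mathbb K$ be a field with $\mathrm{char}(\mathbb K)\neq2$ and let $q\in\mathbb K$ be nonzero and not a root of $1$. On each finite dimensional $U_q(\mathfrak{sl}_2)$-module the actions of $y$ and $z$ are invertible, where $y,z$ are the equitable generators of $U_q(\mathfrak{sl}_2)$.
   Context: $U_q(\mathfrak{sl}_2)$ denotes the unital associative $\mathbb K$-algebra with generators $k^{\pm1},e,f$ and relations $kk^{-1}=k^{-1}k=1$, $ke=q^2ek$, $kf=q^{-2}fk$, $ef-fe=\frac{k-k^{-1}}{q-q^{-1}}$. Its equitable generators are the elements $x^{\pm1}=k^{\pm1}$, $y=k^{-1}+f(q-q^{-1})$, $z=k^{-1}-k^{-1}e\,q(q-q^{-1})$. *)

theory Defs
  imports
    "HOL-Library.Poly_Mapping"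
    "HOL-Algebra.QuotRing"
    "HOL-Algebra.Algebraic_Closure_Type"
begin

text \<open>
  The free monoid on \<open>'g\<close>, in additive notation, as required for the exponents of
  \<open>poly_mapping\<close>. The type \<open>'g free_word \<Rightarrow>\<^sub>0 'k\<close>, with its convolution product, is then the free
  unital associative algebra over \<open>'k\<close> on the generators \<open>'g\<close>.
\<close>

datatype 'g free_word = Word (letters: "'g list")

instantiation free_word :: (type) monoid_add
begin

definition "0 = Word []"

definition "v + w = Word (letters v @ letters w)"

instance
  by standard (simp_all add: zero_free_word_def plus_free_word_def)

end

definition free_gen :: "'g \<Rightarrow> 'g free_word \<Rightarrow>\<^sub>0 'k::ring_1"
  where "free_gen g = Poly_Mapping.single (Word [g]) 1"

definition free_scalar :: "'k \<Rightarrow> 'g free_word \<Rightarrow>\<^sub>0 'k::ring_1"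
  where "free_scalar c = Poly_Mapping.single 0 c"

datatype uq_gen = Gen_k | Gen_k_inv | Gen_e | Gen_f

type_synonym 'k uq_free = "uq_gen free_word \<Rightarrow>\<^sub>0 'k"

text \<open>A relation \<open>l = r\<close> is encoded as the element \<open>l - r\<close> of the free algebra.\<close>

definition uq_relations :: "'k::field \<Rightarrow> 'k uq_free set"
  where "uq_relations q =
    (let k = free_gen Gen_k; k' = free_gen Gen_k_inv; e = free_gen Gen_e; f = free_gen Gen_f in
     {k * k' - 1,
      k' * k - 1,
      k * e - free_scalar (q ^ 2) * e * k,
      k * f - free_scalar (inverse (q ^ 2)) * f * k,
      e * f - f * e - free_scalar (inverse (q - inverse q)) * (k - k')})"

text \<open>In \<open>HOL-Algebra\<close>, an ideal of a non-commutative ring is a two-sided ideal.\<close>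

definition uq_ideal :: "'k::field \<Rightarrow> 'k uq_free set"
  where "uq_ideal q = Idl\<^bsub>ring_of_type_algebra\<^esub> (uq_relations q)"

definition Uq :: "'k::field \<Rightarrow> 'k uq_free set ring"
  where "Uq q = ring_of_type_algebra Quot uq_ideal q"

definition uq_class :: "'k::field \<Rightarrow> 'k uq_free \<Rightarrow> 'k uq_free set"
  where "uq_class q p = uq_ideal q +>\<^bsub>ring_of_type_algebra\<^esub> p"

definition uq_scalar :: "'k::field \<Rightarrow> 'k \<Rightarrow> 'k uq_free set"
  where "uq_scalar q c = uq_class q (free_scalar c)"

definition uq_k :: "'k::field \<Rightarrow> 'k uq_free set"
  where "uq_k q = uq_class q (free_gen Gen_k)"

definition uq_k_inv :: "'k::field \<Rightarrow> 'k uq_free set"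
  where "uq_k_inv q = uq_class q (free_gen Gen_k_inv)"

definition uq_e :: "'k::field \<Rightarrow> 'k uq_free set"
  where "uq_e q = uq_class q (free_gen Gen_e)"

definition uq_f :: "'k::field \<Rightarrow> 'k uq_free set"
  where "uq_f q = uq_class q (free_gen Gen_f)"

definition uq_y :: "'k::field \<Rightarrow> 'k uq_free set"
  where "uq_y q = uq_k_inv q \<oplus>\<^bsub>Uq q\<^esub> uq_f q \<otimes>\<^bsub>Uq q\<^esub> uq_scalar q (q - inverse q)"

definition uq_z :: "'k::field \<Rightarrow> 'k uq_free set"
  where "uq_z q = uq_k_inv q \<ominus>\<^bsub>Uq q\<^esub>
    uq_k_inv q \<otimes>\<^bsub>Uq q\<^esub> uq_e q \<otimes>\<^bsub>Uq q\<^esub> uq_scalar q (q * (q - inverse q))"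

text \<open>
  A left module over \<open>Uq q\<close>, on the vector space given by \<open>scale\<close>. The axiom \<open>act_scalar\<close> says that
  this vector space structure is the one obtained by restriction to the scalars of \<open>Uq q\<close>.
  No condition is imposed on \<open>act a\<close> for \<open>a\<close> outside of \<open>carrier (Uq q)\<close>.
\<close>

locale uq_module = vector_space scale
  for scale :: "'k::field \<Rightarrow> 'v::ab_group_add \<Rightarrow> 'v" +
  fixes q :: 'k and act :: "'k uq_free set \<Rightarrow> 'v \<Rightarrow> 'v"
  assumes act_add_right: "a \<in> carrier (Uq q) \<Longrightarrow> act a (v + w) = act a v + act a w"
    and act_add_left: "\<lbrakk>a \<in> carrier (Uq q); b \<in> carrier (Uq q)\<rbrakk> \<Longrightarrow>
      act (a \<oplus>\<^bsub>Uq q\<^esub> b) v = act a v + act b v"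
    and act_mult: "\<lbrakk>a \<in> carrier (Uq q); b \<in> carrier (Uq q)\<rbrakk> \<Longrightarrow>
      act (a \<otimes>\<^bsub>Uq q\<^esub> b) v = act a (act b v)"
    and act_one: "act \<one>\<^bsub>Uq q\<^esub> v = v"
    and act_scalar: "act (uq_scalar q c) v = scale c v"

lemma ring_free: "ring (ring_of_type_algebra :: 'a::ring_1 ring)"
proof -
  have "\<exists>y. x + y = 0" for x :: 'a
    using add.right_inverse by blast
  then show ?thesis
    unfolding ring_of_type_algebra_def using add.right_inverse
    by unfold_locales (auto simp: algebra_simps Units_def)
qed

lemma ideal_uq_ideal: "ideal (uq_ideal q) ring_of_type_algebra"
  unfolding uq_ideal_def
  by (rule ring.genideal_ideal[OF ring_free]) (simp add: ring_of_type_algebra_def)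

lemma ring_Uq: "ring (Uq q)"
  unfolding Uq_def by (rule ideal.quotient_is_ring[OF ideal_uq_ideal])

lemma uq_class_hom: "uq_class q \<in> ring_hom ring_of_type_algebra (Uq q)"
  unfolding Uq_def uq_class_def
  using ideal.rcos_ring_hom[OF ideal_uq_ideal, of q] by simp

lemma uq_class_in_carrier: "uq_class q p \<in> carrier (Uq q)"
  using ring_hom_closed[OF uq_class_hom, of p q] by (simp add: ring_of_type_algebra_def)

lemma uq_class_mult: "uq_class q (p * r) = uq_class q p \<otimes>\<^bsub>Uq q\<^esub> uq_class q r"
  using ring_hom_mult[OF uq_class_hom, of p r q] by (simp add: ring_of_type_algebra_def)

lemma uq_class_add: "uq_class q (p + r) = uq_class q p \<oplus>\<^bsub>Uq q\<^esub> uq_class q r"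
  using ring_hom_add[OF uq_class_hom, of p r q] by (simp add: ring_of_type_algebra_def)

lemma uq_class_one: "uq_class q 1 = \<one>\<^bsub>Uq q\<^esub>"
  using ring_hom_one[OF uq_class_hom, of q] by (simp add: ring_of_type_algebra_def)

lemma uq_class_minus: "uq_class q (p - r) = uq_class q p \<ominus>\<^bsub>Uq q\<^esub> uq_class q r"
proof -
  interpret U: ring "Uq q" by (rule ring_Uq)
  have "uq_class q p = uq_class q (p - r) \<oplus>\<^bsub>Uq q\<^esub> uq_class q r"
    by (metis uq_class_add diff_add_cancel)
  then show ?thesis
    using uq_class_in_carrier
    by (metis U.add.inv_solve_right a_minus_def)
qed

lemma uq_class_eqI:
  assumes "p - r \<in> uq_relations q"
  shows "uq_class q p = uq_class q r"
proof -
  interpret U: ring "Uq q" by (rule ring_Uq)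
  have "p - r \<in> uq_ideal q"
    unfolding uq_ideal_def
    using ring.genideal_self[OF ring_free, of "uq_relations q"] assms
    by (auto simp: ring_of_type_algebra_def)
  then have "uq_class q (p - r) = \<zero>\<^bsub>Uq q\<^esub>"
    using abelian_subgroup.a_rcos_const[OF abelian_subgroupI3] ideal_uq_ideal[of q]
    by (simp add: uq_class_def Uq_def FactRing_def ideal.axioms(1) ideal_def
        ring.is_abelian_group abelian_subgroupI3 abelian_subgroup.a_rcos_const)
  then show ?thesis
    using uq_class_in_carrier by (metis U.r_right_minus_eq uq_class_minus)
qed

lemma uq_relations_hold:
  shows "uq_k q \<otimes>\<^bsub>Uq q\<^esub> uq_k_inv q = \<one>\<^bsub>Uq q\<^esub>"
    and "uq_k_inv q \<otimes>\<^bsub>Uq q\<^esub> uq_k q = \<one>\<^bsub>Uq q\<^esub>"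
    and "uq_k q \<otimes>\<^bsub>Uq q\<^esub> uq_e q = uq_scalar q (q ^ 2) \<otimes>\<^bsub>Uq q\<^esub> uq_e q \<otimes>\<^bsub>Uq q\<^esub> uq_k q"
    and "uq_k q \<otimes>\<^bsub>Uq q\<^esub> uq_f q = uq_scalar q (inverse (q ^ 2)) \<otimes>\<^bsub>Uq q\<^esub> uq_f q \<otimes>\<^bsub>Uq q\<^esub> uq_k q"
    and "uq_e q \<otimes>\<^bsub>Uq q\<^esub> uq_f q \<ominus>\<^bsub>Uq q\<^esub> uq_f q \<otimes>\<^bsub>Uq q\<^esub> uq_e q =
      uq_scalar q (inverse (q - inverse q)) \<otimes>\<^bsub>Uq q\<^esub> (uq_k q \<ominus>\<^bsub>Uq q\<^esub> uq_k_inv q)"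
  unfolding uq_k_def uq_k_inv_def uq_e_def uq_f_def uq_scalar_def
    uq_class_mult[symmetric] uq_class_minus[symmetric] uq_class_one[symmetric]
  by (rule uq_class_eqI, simp add: uq_relations_def Let_def)+

end

theory Submission
  imports Defs
begin

text \<open>
  Put \<open>c = q - q\<^sup>-\<^sup>1\<close>, which is nonzero because \<open>q\<^sup>2 \<noteq> 1\<close>. On a module,
  \<open>y = k\<^sup>-\<^sup>1 (1 + c k f)\<close> and \<open>z = k\<^sup>-\<^sup>1 (1 - q c e)\<close>. So if \<open>y\<close> or \<open>z\<close> kills a nonzero vector,
  then \<open>k f\<close> or \<open>e\<close>, respectively, has a nonzero eigenvalue.

  Both \<open>k f\<close> and \<open>e\<close> commute with the invertible operator \<open>k\<close> up to a factor \<open>r = q\<^sup>2\<close> or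
  \<open>r = q\<^sup>-\<^sup>2\<close>. An operator \<open>A\<close> of this kind has no nonzero eigenvalue in finite dimension: if
  \<open>A v = \<alpha> v\<close> with \<open>\<alpha>\<close> and \<open>v\<close> nonzero, then \<open>A (k\<^sup>n v) = r\<^sup>n \<alpha> (k\<^sup>n v)\<close>, so that all of the infinitely many scalars
  \<open>r\<^sup>n \<alpha>\<close> would be eigenvalues (lemma \<open>q_commuting_no_nonzero_eigenvalue\<close>).
  Hence \<open>y\<close> and \<open>z\<close> are injective, and by finite dimension they are bijective.
\<close>

section \<open>Operators that commute up to a scalar\<close>

context vector_space
begin

lemma eq_scale_imp_eq_scale_inverse:
  assumes "c \<noteq> 0" and "v = scale c w"
  shows "w = scale (inverse c) v"
  using assms by simp

lemma independent_eigenvectors: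
  assumes A: "Vector_Spaces.linear scale scale A"
    and eigen: "\<And>b. b \<in> B \<Longrightarrow> b \<noteq> 0 \<and> A b = scale (\<mu> b) b"
    and inj: "inj_on \<mu> B"
  shows "independent B"
proof -
  interpret A: Vector_Spaces.linear scale scale A by (rule A)
  have "\<forall>b\<in>S. u b = 0"
    if "finite S" "S \<subseteq> B" "(\<Sum>b\<in>S. scale (u b) b) = 0" for S u
    using that
  proof (induction S arbitrary: u rule: finite_induct)
    case empty
    then show ?case by simp
  next
    case (insert t S)
    have sum0: "scale (u t) t + (\<Sum>b\<in>S. scale (u b) b) = 0"
      using insert by simp
    have A_term: "A (scale (u b) b) = scale (u b * \<mu> b) b" if "b \<in> insert t S" for b
      using eigen[of b] insert.prems(1) that by (auto simp: A.scale)
    have "scale (u t * \<mu> t) t + (\<Sum>b\<in>S. scale (u b * \<mu> b) b) = 0"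
      using arg_cong[OF sum0, of A] A_term by (simp add: A.add A.sum A.zero)
    moreover have "scale (u t * \<mu> t) t + (\<Sum>b\<in>S. scale (u b * \<mu> t) b) = 0"
      using arg_cong[OF sum0, of "scale (\<mu> t)"]
      by (simp add: scale_right_distrib scale_sum_right mult.commute)
    \<comment> \<open>Applying \<open>A - \<mu> t\<close> to the relation removes the term at \<open>t\<close>.\<close>
    ultimately have "(\<Sum>b\<in>S. scale (u b * (\<mu> b - \<mu> t)) b) = 0"
      by (simp add: right_diff_distrib scale_left_diff_distrib sum_subtractf)
        (metis add_left_cancel)
    then have "\<forall>b\<in>S. u b * (\<mu> b - \<mu> t) = 0"
      using insert.IH[of "\<lambda>b. u b * (\<mu> b - \<mu> t)"] insert.prems(1) by simp
    moreover have "\<mu> b \<noteq> \<mu> t" if "b \<in> S" for b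
      using inj insert.prems(1) insert.hyps(2) that by (auto dest: inj_onD)
    ultimately have "\<forall>b\<in>S. u b = 0" by auto
    moreover from this have "u t = 0"
      using sum0 eigen[of t] insert.prems(1) by simp
    ultimately show ?case by simp
  qed
  then show ?thesis
    unfolding dependent_explicit by blast
qed

end

context finite_dimensional_vector_space
begin

lemma finite_eigenvalues:
  assumes A: "Vector_Spaces.linear scale scale A"
  shows "finite {\<alpha>. \<exists>v. v \<noteq> 0 \<and> A v = scale \<alpha> v}" (is "finite ?L")
proof -
  obtain w where w: "\<And>\<alpha>. \<alpha> \<in> ?L \<Longrightarrow> w \<alpha> \<noteq> 0 \<and> A (w \<alpha>) = scale \<alpha> (w \<alpha>)"
    by (atomize_elim, rule choice) auto
  have inj: "inj_on w ?L"
  proof (rule inj_onI)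
    fix a b assume "a \<in> ?L" "b \<in> ?L" "w a = w b"
    then have "scale a (w a) = scale b (w a)" "w a \<noteq> 0"
      using w by metis+
    then show "a = b" by simp
  qed
  have "independent (w ` ?L)"
  proof (rule independent_eigenvectors[OF A])
    show "b \<noteq> 0 \<and> A b = scale (inv_into ?L w b) b" if "b \<in> w ` ?L" for b
      using w[OF inv_into_into[OF that]] f_inv_into_f[OF that] by simp
    show "inj_on (inv_into ?L w) (w ` ?L)"
      by (rule inj_on_inv_into) simp
  qed
  then show ?thesis
    using finiteI_independent finite_imageD inj by blast
qed

text \<open>
  The operator \<open>K\<close> takes an eigenvector of \<open>A\<close> for \<open>\<alpha>\<close> to one for \<open>r \<alpha>\<close>. As the powers of \<open>r\<close>
  are pairwise different, a single eigenvalue \<open>\<alpha> \<noteq> 0\<close> would produce infinitely many.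
\<close>

lemma q_commuting_no_nonzero_eigenvalue:
  assumes A: "Vector_Spaces.linear scale scale A"
    and K: "Vector_Spaces.linear scale scale K"
    and K_nonzero: "\<And>u. u \<noteq> 0 \<Longrightarrow> K u \<noteq> 0"
    and comm: "\<And>u. A (K u) = scale r (K (A u))"
    and r: "inj (\<lambda>n::nat. r ^ n)"
    and Av: "A v = scale \<alpha> v" and "\<alpha> \<noteq> 0"
  shows "v = 0"
proof (rule ccontr)
  assume "v \<noteq> 0"
  interpret K: Vector_Spaces.linear scale scale K by (rule K)
  have "(K ^^ n) v \<noteq> 0 \<and> A ((K ^^ n) v) = scale (r ^ n * \<alpha>) ((K ^^ n) v)" for n
    by (induction n) (use \<open>v \<noteq> 0\<close> Av in \<open>auto simp: K_nonzero comm K.scale mult.assoc\<close>)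
  then have "range (\<lambda>n. r ^ n * \<alpha>) \<subseteq> {\<alpha>. \<exists>v. v \<noteq> 0 \<and> A v = scale \<alpha> v}"
    by blast
  then have "finite (range (\<lambda>n::nat. r ^ n * \<alpha>))"
    using finite_eigenvalues[OF A] finite_subset by blast
  moreover have "inj (\<lambda>n::nat. r ^ n * \<alpha>)"
    using r \<open>\<alpha> \<noteq> 0\<close> by (simp add: inj_def)
  ultimately show False
    using finite_imageD by blast
qed

end

lemma inj_power_if_not_root_of_unity:
  fixes r :: "'k::field"
  assumes "r \<noteq> 0" and "\<And>n::nat. n > 0 \<Longrightarrow> r ^ n \<noteq> 1"
  shows "inj (\<lambda>n::nat. r ^ n)"
proof (rule linorder_injI)
  fix m n :: nat assume "m < n"
  then have "r ^ n = r ^ m * r ^ (n - m)" "r ^ (n - m) \<noteq> 1"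
    using assms(2) by (simp_all flip: power_add)
  then show "r ^ m \<noteq> r ^ n"
    using assms(1) by simp
qed

section \<open>The operators of a module\<close>

text \<open>
  The module axioms give additivity of the action; its homogeneity comes from the centrality of
  the scalars.
\<close>

lemma free_scalar_central: "free_scalar c * p = p * (free_scalar c :: 'k::comm_ring_1 uq_free)"
proof (induction p rule: Poly_Mapping.update_induct)
  case const
  show ?case by simp
next
  case (update p w d)
  have "Poly_Mapping.update w d p = p + Poly_Mapping.single w d"
    using update.hyps(1)
    by (auto intro!: poly_mapping_eqI
        simp: lookup_update lookup_add lookup_single in_keys_iff when_def)
  then show ?case
    using update.IH
    by (simp add: algebra_simps) (simp add: free_scalar_def mult_single mult.commute)
qed

text \<open>
  Composing the action with \<open>uq_class q\<close> makes the module a representation of the free algebra, so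
  that computations take place in a type class ring rather than in the quotient.
\<close>

context uq_module
begin

abbreviation op :: "'k uq_free \<Rightarrow> 'v \<Rightarrow> 'v"
  where "op p \<equiv> act (uq_class q p)"

lemma op_mult: "op (p * r) v = op p (op r v)"
  by (simp add: uq_class_mult act_mult uq_class_in_carrier)

lemma op_add: "op (p + r) v = op p v + op r v"
  by (simp add: uq_class_add act_add_left uq_class_in_carrier)

lemma op_diff: "op (p - r) v = op p v - op r v"
  using op_add[of "p - r" r v] by simp

lemma op_one: "op 1 v = v"
  by (simp add: uq_class_one act_one)

lemma op_scalar: "op (free_scalar c) v = scale c v"
  using act_scalar by (simp add: uq_scalar_def)

lemma linear_op: "Vector_Spaces.linear scale scale (op p)"
proof (unfold_locales)
  show "op p (v + w) = op p v + op p w" for v w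
    by (simp add: act_add_right uq_class_in_carrier)
  show "op p (scale c v) = scale c (op p v)" for c v
    by (metis op_mult op_scalar free_scalar_central)
qed

lemma op_scale: "op p (scale c v) = scale c (op p v)"
proof -
  interpret P: Vector_Spaces.linear scale scale "op p" by (rule linear_op)
  show ?thesis by (rule P.scale)
qed

lemma op_zero: "op p 0 = 0"
  using op_scale[of p 0 0] by simp

lemma op_relation:
  assumes "p - r \<in> uq_relations q"
  shows "op p v = op r v"
  by (simp add: uq_class_eqI[OF assms])

lemma op_k_k_inv: "op (free_gen Gen_k) (op (free_gen Gen_k_inv) v) = v"
  using op_relation[of "free_gen Gen_k * free_gen Gen_k_inv" 1 v]
  by (simp add: uq_relations_def Let_def op_mult op_one)

lemma op_k_inv_k: "op (free_gen Gen_k_inv) (op (free_gen Gen_k) v) = v"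
  using op_relation[of "free_gen Gen_k_inv * free_gen Gen_k" 1 v]
  by (simp add: uq_relations_def Let_def op_mult op_one)

lemma op_k_e: "op (free_gen Gen_k) (op (free_gen Gen_e) v) =
    scale (q ^ 2) (op (free_gen Gen_e) (op (free_gen Gen_k) v))"
  using op_relation[of "free_gen Gen_k * free_gen Gen_e"
      "free_scalar (q ^ 2) * free_gen Gen_e * free_gen Gen_k" v]
  by (simp add: uq_relations_def Let_def op_mult op_scalar)

lemma op_k_f: "op (free_gen Gen_k) (op (free_gen Gen_f) v) =
    scale (inverse (q ^ 2)) (op (free_gen Gen_f) (op (free_gen Gen_k) v))"
  using op_relation[of "free_gen Gen_k * free_gen Gen_f"
      "free_scalar (inverse (q ^ 2)) * free_gen Gen_f * free_gen Gen_k" v]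
  by (simp add: uq_relations_def Let_def op_mult op_scalar)

lemma op_k_nonzero: "u \<noteq> 0 \<Longrightarrow> op (free_gen Gen_k) u \<noteq> 0"
  by (metis op_k_inv_k op_zero)

end

lemma uq_y_eq_class:
  "uq_y q = uq_class q (free_gen Gen_k_inv + free_gen Gen_f * free_scalar (q - inverse q))"
  by (simp add: uq_y_def uq_k_inv_def uq_f_def uq_scalar_def uq_class_add uq_class_mult)

lemma uq_z_eq_class:
  "uq_z q = uq_class q (free_gen Gen_k_inv -
    free_gen Gen_k_inv * free_gen Gen_e * free_scalar (q * (q - inverse q)))"
  by (simp add: uq_z_def uq_k_inv_def uq_e_def uq_scalar_def uq_class_minus uq_class_mult)

section \<open>Invertibility of the equitable generators\<close>

locale finite_dimensional_uq_module =
  uq_module scale q act + finite_dimensional_vector_space scale Basis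
  for scale :: "'k::field \<Rightarrow> 'v::ab_group_add \<Rightarrow> 'v" and q act Basis +
  assumes q_nonzero: "q \<noteq> 0"
    and q_not_root: "n > 0 \<Longrightarrow> q ^ n \<noteq> 1"
begin

lemma inj_power_q_square: "inj (\<lambda>n::nat. (q ^ 2) ^ n)"
proof (rule inj_power_if_not_root_of_unity)
  show "(q ^ 2) ^ n \<noteq> 1" if "n > 0" for n
    using q_not_root[of "2 * n"] that by (simp flip: power_mult)
qed (simp add: q_nonzero)

lemma inj_power_inverse_q_square: "inj (\<lambda>n::nat. inverse (q ^ 2) ^ n)"
  using inj_power_q_square by (simp add: inj_def power_inverse)

lemma q_minus_inverse_nonzero: "q - inverse q \<noteq> 0"
  using q_not_root[of 2] q_nonzero by (auto simp: field_simps power2_eq_square)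

lemma bij_op_if_trivial_kernel:
  assumes "\<And>v. op p v = 0 \<Longrightarrow> v = 0"
  shows "bij (op p)"
proof -
  interpret P: Vector_Spaces.linear scale scale "op p" by (rule linear_op)
  have "inj (op p)"
    using assms P.inj_iff_eq_0 by blast
  then show ?thesis
    using linear_inj_imp_surj[OF linear_op] by (simp add: bij_def)
qed

lemma bij_uq_y: "bij (act (uq_y q))"
  unfolding uq_y_eq_class
proof (rule bij_op_if_trivial_kernel)
  let ?k = "free_gen Gen_k" and ?f = "free_gen Gen_f" and ?c = "q - inverse q"
  fix v
  assume "op (free_gen Gen_k_inv + ?f * free_scalar ?c) v = 0"
  \<comment> \<open>Multiplying by \<open>k\<close> from the left turns \<open>y\<close> into \<open>1 + c k f\<close>.\<close>
  then have "op ?k (op (free_gen Gen_k_inv) v + scale ?c (op ?f v)) = 0"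
    by (simp add: op_add op_mult op_scalar op_scale op_zero)
  then have "v + scale ?c (op (?k * ?f) v) = 0"
    by (simp add: act_add_right uq_class_in_carrier op_k_k_inv op_scale op_mult)
  then have "v = scale (- ?c) (op (?k * ?f) v)"
    by (simp only: scale_minus_left eq_neg_iff_add_eq_0)
  then have eigen: "op (?k * ?f) v = scale (inverse (- ?c)) v"
    using q_minus_inverse_nonzero by (intro eq_scale_imp_eq_scale_inverse) auto
  show "v = 0"
  proof (rule q_commuting_no_nonzero_eigenvalue[OF linear_op linear_op op_k_nonzero _ _ eigen])
    show "op (?k * ?f) (op ?k u) = scale (q ^ 2) (op ?k (op (?k * ?f) u))" for u
      using q_nonzero by (simp add: op_mult op_k_f op_scale)
    show "inj (\<lambda>n::nat. (q ^ 2) ^ n)" by (rule inj_power_q_square)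
    show "inverse (- ?c) \<noteq> 0" using q_minus_inverse_nonzero by simp
  qed
qed

lemma bij_uq_z: "bij (act (uq_z q))"
  unfolding uq_z_eq_class
proof (rule bij_op_if_trivial_kernel)
  let ?k = "free_gen Gen_k" and ?k' = "free_gen Gen_k_inv" and ?e = "free_gen Gen_e"
    and ?c = "q * (q - inverse q)"
  have c: "?c \<noteq> 0" using q_nonzero q_minus_inverse_nonzero by simp
  fix v
  assume "op (?k' - ?k' * ?e * free_scalar ?c) v = 0"
  then have "op ?k' v = op ?k' (scale ?c (op ?e v))"
    by (simp add: op_diff op_mult op_scalar op_scale)
  then have "v = scale ?c (op ?e v)"
    by (metis op_k_k_inv)
  then have eigen: "op ?e v = scale (inverse ?c) v"
    using c by (intro eq_scale_imp_eq_scale_inverse)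
  show "v = 0"
  proof (rule q_commuting_no_nonzero_eigenvalue[OF linear_op linear_op op_k_nonzero _ _ eigen])
    show "op ?e (op ?k u) = scale (inverse (q ^ 2)) (op ?k (op ?e u))" for u
      using q_nonzero by (simp add: op_k_e)
    show "inj (\<lambda>n::nat. inverse (q ^ 2) ^ n)" by (rule inj_power_inverse_q_square)
    show "inverse ?c \<noteq> 0" using c by simp
  qed
qed

end

theorem corollary4p5:
  fixes q :: "'k::field"
    and scale :: "'k \<Rightarrow> 'v::ab_group_add \<Rightarrow> 'v"
    and act :: "'k uq_free set \<Rightarrow> 'v \<Rightarrow> 'v"
  assumes "CHAR('k) \<noteq> 2"
    and "q \<noteq> 0"
    and "\<forall>n::nat. n > 0 \<longrightarrow> q ^ n \<noteq> 1"
    and "uq_module scale q act"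
    and "\<exists>Basis. finite_dimensional_vector_space scale Basis"
  shows "bij (act (uq_y q)) \<and> bij (act (uq_z q))"
proof -
  obtain Basis where "finite_dimensional_vector_space scale Basis"
    using assms(5) by blast
  then interpret finite_dimensional_uq_module scale q act Basis
    using assms(2-4)
    by (simp add: finite_dimensional_uq_module_def finite_dimensional_uq_module_axioms_def)
  show ?thesis
    using bij_uq_y bij_uq_z by blast
qed

end
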